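(* For every integer $n\ge 1$, $$\sum_{k=0}^{n-1}(-1)^k\binom{n}{k+1}\binom{n-1}{k}\,b_k=1,$$ where $b_k$ denotes the number of complete non-ambiguous trees with $k$ internal vertices.
   Context: $\mathbb{N}=\{0,1,2,\dots\}$. For a point $p\in\mathbb{N}\times\mathbb{N}$ write $p=(X(p),Y(p))$. A row is a set of points with fixed $X$, a column a set of points with fixed $Y$. A non-ambiguous tree of size $n$ is a set $A$ of $n$ points of $\mathbb{N}\times\mathbb{N}$ such that: (1) $(0,0)\in A$ (the root); (2) for each non-root $p\in A$, exactly one of the following holds: there is $q\in A$ with $X(q)=X(p)$, $Y(q)<Y(p)$; there is $r\in A$ with $Y(r)=Y(p)$, $X(r)<X(p)$; (3) if some $p\in A$ has $X(p)=x$ (resp. $Y(p)=y$), then for every $0\le x'<x$ (resp. $0\le y'<y$) some $q\in A$ has $X(q)=x'$ (resp. $Y(q)=y'$). $A$ has a binary tree structure with root $(0,0)$: the parent of a non-root $p$ is the nearest point of $A$ preceding $p$ in its row (then $p$ is a right child) or in its column (then $p$ is a left child). A non-ambiguous tree is complete if each of its vertices has either $0$ or $2$ children; vertices with $2$ children are internal. *)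

theory Defs
  imports Main
begin

(* A point p of N x N is a pair with X(p) = fst p and Y(p) = snd p;
   a row has constant first coordinate, a column constant second coordinate. *)
type_synonym point = "nat \<times> nat"

definition row_precedes :: "point \<Rightarrow> point \<Rightarrow> bool" where
  "row_precedes q p \<longleftrightarrow> fst q = fst p \<and> snd q < snd p"

definition column_precedes :: "point \<Rightarrow> point \<Rightarrow> bool" where
  "column_precedes q p \<longleftrightarrow> snd q = snd p \<and> fst q < fst p"

(* The disequality of the two truth values below says that exactly one of them holds. *)
definition non_ambiguous_tree :: "nat \<Rightarrow> point set \<Rightarrow> bool" where
  "non_ambiguous_tree n A \<longleftrightarrow>
     finite A \<and> card A = n \<and>
     (0, 0) \<in> A \<and>
     (\<forall>p\<in>A. p \<noteq> (0, 0) \<longrightarrow>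
        (\<exists>q\<in>A. row_precedes q p) \<noteq> (\<exists>r\<in>A. column_precedes r p)) \<and>
     (\<forall>p\<in>A. (\<forall>x'<fst p. \<exists>q\<in>A. fst q = x') \<and> (\<forall>y'<snd p. \<exists>q\<in>A. snd q = y'))"

definition right_child :: "point set \<Rightarrow> point \<Rightarrow> point \<Rightarrow> bool" where
  "right_child A p c \<longleftrightarrow> p \<in> A \<and> c \<in> A \<and> row_precedes p c \<and>
     \<not> (\<exists>q\<in>A. row_precedes p q \<and> row_precedes q c)"

definition left_child :: "point set \<Rightarrow> point \<Rightarrow> point \<Rightarrow> bool" where
  "left_child A p c \<longleftrightarrow> p \<in> A \<and> c \<in> A \<and> column_precedes p c \<and>
     \<not> (\<exists>q\<in>A. column_precedes p q \<and> column_precedes q c)"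

definition children :: "point set \<Rightarrow> point \<Rightarrow> point set" where
  "children A p = {c. left_child A p c \<or> right_child A p c}"

definition complete_tree :: "point set \<Rightarrow> bool" where
  "complete_tree A \<longleftrightarrow> (\<forall>p\<in>A. card (children A p) = 0 \<or> card (children A p) = 2)"

definition internal_vertices :: "point set \<Rightarrow> point set" where
  "internal_vertices A = {p\<in>A. card (children A p) = 2}"

definition complete_nats :: "nat \<Rightarrow> point set set" where
  "complete_nats k =
     {A. (\<exists>n. non_ambiguous_tree n A) \<and> complete_tree A \<and> card (internal_vertices A) = k}"

(* The set is finite: such a tree has 2k+1 points, and since no coordinate value below an
   occupied one is missing, they all lie in a bounded square. *)
definition num_complete_nats :: "nat \<Rightarrow> nat" where
  "num_complete_nats k = card (complete_nats k)"

end

theory Submission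
  imports Defs "HOL-Computational_Algebra.Formal_Power_Series"
begin

text \<open>
  Deleting the root of a complete non-ambiguous tree leaves the subtrees of its left and right
  child, and these share no row and no column. A tree with \<open>k\<close> internal vertices occupies
  \<open>k + 1\<close> rows and \<open>k + 1\<close> columns, so choosing the rows of the left and the columns of the
  right subtree gives
  \<open>b\<^sub>k = (\<Sum>i<k. (k choose (i + 1)) * (k choose i) * b\<^sub>i * b\<^sub>k\<^sub>-\<^sub>1\<^sub>-\<^sub>i)\<close>.
  For \<open>u = (\<Sum>k. b\<^sub>k x\<^sup>k / (k! (k + 1)!))\<close> this is the Riccati equation \<open>(x u)' = 1 + x u\<^sup>2\<close>, which
  is solved by \<open>u = - J' / J\<close> with \<open>J = (\<Sum>m. (- x)\<^sup>m / m!\<^sup>2)\<close>. The theorem compares coefficients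
  in \<open>u J = - J'\<close>.
\<close>

section \<open>Recursive description of complete trees\<close>

text \<open>The numbers are the coordinates of the root. Gaps between occupied rows or columns are
  allowed, because a subtree uses only some of those of the whole tree. In \<open>node\<close>,
  \<open>A\<close> is the left subtree, rooted in column \<open>c\<close>, and \<open>B\<close> the
  right one, rooted in row \<open>r\<close>.\<close>

inductive grid_tree :: "nat \<Rightarrow> nat \<Rightarrow> point set \<Rightarrow> bool" where
  leaf: "grid_tree r c {(r, c)}"
| node: "\<lbrakk>grid_tree r' c A; grid_tree r c' B; r < r'; c < c';
    fst ` A \<inter> fst ` B = {}; snd ` A \<inter> snd ` B = {}\<rbrakk>
    \<Longrightarrow> grid_tree r c (insert (r, c) (A \<union> B))"

lemma grid_tree_finite: "grid_tree r c A \<Longrightarrow> finite A"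
  by (induction rule: grid_tree.induct) auto

lemma grid_tree_root: "grid_tree r c A \<Longrightarrow> (r, c) \<in> A"
  by (induction rule: grid_tree.induct) auto

lemma grid_tree_ge: "grid_tree r c A \<Longrightarrow> p \<in> A \<Longrightarrow> r \<le> fst p \<and> c \<le> snd p"
  by (induction arbitrary: p rule: grid_tree.induct) fastforce+

lemma grid_tree_Min:
  assumes "grid_tree r c A"
  shows "Min (fst ` A) = r" "Min (snd ` A) = c"
  using grid_tree_finite[OF assms] grid_tree_root[OF assms] grid_tree_ge[OF assms]
  by (auto intro!: Min_eqI simp: image_iff) force+

text \<open>Each subtree root shares a row or a column with its parent, so a tree contained in two
  parts without common rows or columns never leaves the part of its root.\<close>

lemma grid_tree_subset_component:
  assumes "grid_tree r c A" "A \<subseteq> S \<union> S'" "(r, c) \<in> S"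
    "fst ` S \<inter> fst ` S' = {}" "snd ` S \<inter> snd ` S' = {}"
  shows "A \<subseteq> S"
  using assms
proof (induction rule: grid_tree.induct)
  case (leaf r c)
  then show ?case by simp
next
  case (node r' c A r c' B)
  have "(r', c) \<in> A" "(r, c') \<in> B"
    using node.hyps grid_tree_root by auto
  then have "(r', c) \<in> S" "(r, c') \<in> S"
    using node.prems by force+
  then show ?case
    using node.IH node.prems by auto
qed

text \<open>A node determines its two subtrees. Column \<open>c\<close> singles out the left one and
  row \<open>r\<close> the right one, so the root of \<open>A\<close> lies in \<open>A'\<close>;
  \<open>grid_tree_subset_component\<close> then carries all of \<open>A\<close> along. The other
  inclusions are alike.\<close>

lemma grid_tree_node_inject:
  assumes "grid_tree r1 c A" "grid_tree r c1 B" "r < r1" "c < c1"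
    "fst ` A \<inter> fst ` B = {}" "snd ` A \<inter> snd ` B = {}"
    and "grid_tree r2 c A'" "grid_tree r c2 B'" "r < r2" "c < c2"
    "fst ` A' \<inter> fst ` B' = {}" "snd ` A' \<inter> snd ` B' = {}"
    and eq: "insert (r, c) (A \<union> B) = insert (r, c) (A' \<union> B')"
  shows "A = A' \<and> B = B'"
proof -
  have "(r, c) \<notin> A \<union> B" "(r, c) \<notin> A' \<union> B'"
    using assms grid_tree_ge by (metis Un_iff fst_conv snd_conv leD)+
  then have eq': "A \<union> B = A' \<union> B'" using eq by (metis insert_ident)
  have roots: "(r1, c) \<in> A" "(r, c1) \<in> B" "(r2, c) \<in> A'" "(r, c2) \<in> B'"
    using assms grid_tree_root by auto
  have mem: "p \<in> A \<union> B" if "p \<in> A' \<union> B'" for p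
    using that eq' by simp
  have mem': "p \<in> A' \<union> B'" if "p \<in> A \<union> B" for p
    using that eq' by simp
  \<comment> \<open>\<open>B'\<close> has no point in column \<open>c\<close>, because that column
    is already taken by the root \<open>(r2, c)\<close> of \<open>A'\<close>.\<close>
  have "(r1, c) \<in> A'" using mem'[of "(r1, c)"] roots assms(12) by force
  then have "A \<subseteq> A'"
    using grid_tree_subset_component[OF assms(1) _ _ assms(11,12)] eq' by blast
  moreover have "(r2, c) \<in> A" using mem[of "(r2, c)"] roots assms(6) by force
  then have "A' \<subseteq> A"
    using grid_tree_subset_component[OF assms(7) _ _ assms(5,6)] eq' by blast
  moreover have "(r, c1) \<in> B'" using mem'[of "(r, c1)"] roots assms(11) by force
  then have "B \<subseteq> B'"
    using grid_tree_subset_component[OF assms(2), of B' A'] assms(11,12) eq' by blast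
  moreover have "(r, c2) \<in> B" using mem[of "(r, c2)"] roots assms(5) by force
  then have "B' \<subseteq> B"
    using grid_tree_subset_component[OF assms(8), of B A] assms(5,6) eq' by blast
  ultimately show ?thesis by blast
qed

lemma grid_tree_nodeE:
  assumes "grid_tree r c A" "A \<noteq> {(r, c)}"
  obtains r' c' A1 A2 where "grid_tree r' c A1" "grid_tree r c' A2" "r < r'" "c < c'"
    "fst ` A1 \<inter> fst ` A2 = {}" "snd ` A1 \<inter> snd ` A2 = {}" "A = insert (r, c) (A1 \<union> A2)"
  using assms by (cases rule: grid_tree.cases) auto

section \<open>Grid trees are complete non-ambiguous trees\<close>

text \<open>Both the children of \<open>p\<close> and the points that could separate them from
  \<open>p\<close> come after \<open>p\<close> in its row or column, so passing to a larger set
  changes nothing if all such points already lie in \<open>S\<close>.\<close>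

lemma children_cong_subset:
  assumes "S \<subseteq> T" "p \<in> S"
    "\<And>q. q \<in> T \<Longrightarrow> row_precedes p q \<or> column_precedes p q \<Longrightarrow> q \<in> S"
  shows "children T p = children S p"
  using assms unfolding children_def left_child_def right_child_def by blast

lemma children_root:
  assumes col: "(r', c) \<in> T" "r < r'" "\<And>x. (x, c) \<in> T \<Longrightarrow> x = r \<or> r' \<le> x"
    and row: "(r, c') \<in> T" "c < c'" "\<And>y. (r, y) \<in> T \<Longrightarrow> y = c \<or> c' \<le> y"
    and root: "(r, c) \<in> T"
  shows "children T (r, c) = {(r', c), (r, c')}"
proof -
  have "left_child T (r, c) (x, y) \<longleftrightarrow> (x, y) = (r', c)" for x y
  proof
    assume l: "left_child T (r, c) (x, y)"
    then have x: "y = c" "(x, c) \<in> T" "r < x"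
      by (auto simp: left_child_def column_precedes_def)
    then have "r' \<le> x" using col(3) by fastforce
    moreover have "\<not> r' < x"
      using l col(1,2) x by (auto simp: left_child_def column_precedes_def)
    ultimately show "(x, y) = (r', c)" using x by simp
  next
    assume "(x, y) = (r', c)"
    then show "left_child T (r, c) (x, y)"
      using col root by (fastforce simp: left_child_def column_precedes_def)
  qed
  moreover have "right_child T (r, c) (x, y) \<longleftrightarrow> (x, y) = (r, c')" for x y
  proof
    assume l: "right_child T (r, c) (x, y)"
    then have y: "x = r" "(r, y) \<in> T" "c < y"
      by (auto simp: right_child_def row_precedes_def)
    then have "c' \<le> y" using row(3) by fastforce
    moreover have "\<not> c' < y"
      using l row(1,2) y by (auto simp: right_child_def row_precedes_def)
    ultimately show "(x, y) = (r, c')" using y by simp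
  next
    assume "(x, y) = (r, c')"
    then show "right_child T (r, c) (x, y)"
      using row root by (fastforce simp: right_child_def row_precedes_def)
  qed
  ultimately show ?thesis
    unfolding children_def by auto
qed

lemma children_singleton: "children {p} q = {}"
  unfolding children_def left_child_def right_child_def row_precedes_def column_precedes_def
  by (cases p) auto

text \<open>No row or column meets both subtrees, so predecessors and children are inherited from
  them, apart from the effect of the new root. The row and column counts of the subtrees add up
  while the root is one more internal vertex:
  \<open>(i + 1) + (j + 1) = (i + j + 1) + 1\<close>.\<close>

lemma grid_tree_structure:
  assumes "grid_tree r c A"
  shows "(\<forall>p\<in>A. p \<noteq> (r, c) \<longrightarrow>
        (\<exists>q\<in>A. row_precedes q p) \<noteq> (\<exists>q\<in>A. column_precedes q p)) \<and> complete_tree A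
     \<and> card (fst ` A) = Suc (card (internal_vertices A))
     \<and> card (snd ` A) = Suc (card (internal_vertices A))"
  using assms
proof (induction rule: grid_tree.induct)
  case (leaf r c)
  then show ?case
    by (simp add: complete_tree_def internal_vertices_def children_singleton)
next
  case (node r' c A r c' B)
  define T where "T = insert (r, c) (A \<union> B)"
  have fin: "finite A" "finite B" and roots: "(r', c) \<in> A" "(r, c') \<in> B"
    using node.hyps grid_tree_finite grid_tree_root by auto
  have geA: "r' \<le> x \<and> c \<le> y" if "(x, y) \<in> A" for x y
    using grid_tree_ge[OF node.hyps(1) that] by simp
  have geB: "r \<le> x \<and> c' \<le> y" if "(x, y) \<in> B" for x y
    using grid_tree_ge[OF node.hyps(2) that] by simp
  have notrow: "r \<noteq> x" if "(x, y) \<in> A" for x y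
    using geA[OF that] \<open>r < r'\<close> by simp
  have notcol: "c \<noteq> y" if "(x, y) \<in> B" for x y
    using geB[OF that] \<open>c < c'\<close> by simp
  have disj: "fst p \<noteq> fst q" "snd p \<noteq> snd q" if "p \<in> A" "q \<in> B" for p q
    using that node.hyps(5,6) by blast+
  have inA: "q \<in> A" if "p \<in> A" "q \<in> T" "row_precedes p q \<or> column_precedes p q" for p q
    using that disj[of p q] geA[of "fst p" "snd p"] \<open>r < r'\<close> unfolding T_def
    by (auto simp: row_precedes_def column_precedes_def)
  have inB: "q \<in> B" if "p \<in> B" "q \<in> T" "row_precedes p q \<or> column_precedes p q" for p q
    using that disj[of q p] geB[of "fst p" "snd p"] \<open>c < c'\<close> unfolding T_def
    by (auto simp: row_precedes_def column_precedes_def)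
  have chA: "children T p = children A p" if "p \<in> A" for p
    by (rule children_cong_subset[OF _ that inA[OF that]]) (auto simp: T_def)
  have chB: "children T p = children B p" if "p \<in> B" for p
    by (rule children_cong_subset[OF _ that inB[OF that]]) (auto simp: T_def)
  have notin': "(r, y) \<notin> A" "(x, c) \<notin> B" for x y
    using notrow notcol by auto
  have chroot: "children T (r, c) = {(r', c), (r, c')}"
    by (rule children_root)
      (use roots node.hyps(3,4) geA geB notin' in \<open>auto simp: T_def\<close>)
  have card2: "card (children T (r, c)) = 2"
    using chroot \<open>r < r'\<close> by simp
  have notin: "(r, c) \<notin> A" "(r, c) \<notin> B" by (fact notin')+
  have disj': "A \<inter> B = {}" using disj(1) by blast
  have int: "internal_vertices T = insert (r, c) (internal_vertices A \<union> internal_vertices B)"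
    using chA chB card2 unfolding internal_vertices_def T_def[symmetric]
    by (auto simp: T_def)
  have subs: "internal_vertices A \<subseteq> A" "internal_vertices B \<subseteq> B"
    by (auto simp: internal_vertices_def)
  have fin_int: "finite (internal_vertices A)" "finite (internal_vertices B)"
    using subs fin finite_subset by blast+
  have "(r, c) \<notin> internal_vertices A \<union> internal_vertices B"
    "internal_vertices A \<inter> internal_vertices B = {}"
    using subs notin disj' by blast+
  then have cardint: "card (internal_vertices T)
      = Suc (card (internal_vertices A) + card (internal_vertices B))"
    unfolding int using fin_int by (simp add: card_Un_disjoint)
  \<comment> \<open>The root opens no new row or column: its row occurs in \<open>B\<close> and its
    column in \<open>A\<close>.\<close>
  have "r \<in> fst ` B" "c \<in> snd ` A"
    using roots by (auto intro: rev_image_eqI)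
  then have rows: "fst ` T = fst ` A \<union> fst ` B" "snd ` T = snd ` A \<union> snd ` B"
    unfolding T_def by auto
  have cards: "card (fst ` T) = Suc (card (internal_vertices T))"
    "card (snd ` T) = Suc (card (internal_vertices T))"
    unfolding rows cardint using node.hyps(5,6) node.IH fin by (simp_all add: card_Un_disjoint)
  have complete: "complete_tree T"
    unfolding complete_tree_def
  proof
    fix p assume "p \<in> T"
    then consider "p = (r, c)" | "p \<in> A" | "p \<in> B" unfolding T_def by blast
    then show "card (children T p) = 0 \<or> card (children T p) = 2"
      by cases (use chA chB card2 node.IH in \<open>auto simp: complete_tree_def\<close>)
  qed
  have "(\<exists>q\<in>T. row_precedes q p) \<noteq> (\<exists>q\<in>T. column_precedes q p)"
    if p: "p \<in> T" "p \<noteq> (r, c)" for p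
  proof -
    consider "p = (r', c)" | "p \<in> A" "p \<noteq> (r', c)" | "p = (r, c')" | "p \<in> B" "p \<noteq> (r, c')"
      using p unfolding T_def by blast
    then show ?thesis
    proof cases
      \<comment> \<open>The root of the left subtree gains exactly one kind of predecessor, namely
        the new root in its column.\<close>
      case 1
      have "\<not> row_precedes q p" if "q \<in> T" for q
        using that 1 roots disj(1)[of "(r', c)" q] geA[of "fst q" "snd q"] \<open>r < r'\<close>
        unfolding T_def row_precedes_def by auto
      moreover have "column_precedes (r, c) p"
        using 1 \<open>r < r'\<close> by (simp add: column_precedes_def)
      ultimately show ?thesis unfolding T_def by blast
    next
      case 2
      have "(\<exists>q\<in>T. row_precedes q p) \<longleftrightarrow> (\<exists>q\<in>A. row_precedes q p)"
        using 2 disj(1)[of p "(fst p, y)" for y] notrow[of "fst p" "snd p"] unfolding T_def row_precedes_def by fastforce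
      moreover have "(\<exists>q\<in>T. column_precedes q p) \<longleftrightarrow> (\<exists>q\<in>A. column_precedes q p)"
      proof (cases "snd p = c")
        case True
        \<comment> \<open>In column \<open>c\<close> the new root is an additional predecessor, but
          \<open>p\<close> already had one inside \<open>A\<close>, so the truth value is
          unchanged.\<close>
        then have "column_precedes (r', c) p"
          using 2 geA[of "fst p" "snd p"] by (cases p) (auto simp: column_precedes_def)
        then show ?thesis using roots unfolding T_def by blast
      next
        case False
        then show ?thesis using 2 disj(2)[of p "(x, snd p)" for x] unfolding T_def column_precedes_def by fastforce
      qed
      ultimately show ?thesis using node.IH(1) 2 by simp
    next
      case 3
      have "\<not> column_precedes q p" if "q \<in> T" for q
        using that 3 roots disj(2)[of q "(r, c')"] geB[of "fst q" "snd q"] \<open>c < c'\<close>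
        unfolding T_def column_precedes_def by auto
      moreover have "row_precedes (r, c) p"
        using 3 \<open>c < c'\<close> by (simp add: row_precedes_def)
      ultimately show ?thesis unfolding T_def by blast
    next
      case 4
      have "(\<exists>q\<in>T. column_precedes q p) \<longleftrightarrow> (\<exists>q\<in>B. column_precedes q p)"
        using 4 disj(2)[of "(x, snd p)" p for x] notcol[of "fst p" "snd p"] unfolding T_def column_precedes_def
        by fastforce
      moreover have "(\<exists>q\<in>T. row_precedes q p) \<longleftrightarrow> (\<exists>q\<in>B. row_precedes q p)"
      proof (cases "fst p = r")
        case True
        then have "row_precedes (r, c') p"
          using 4 geB[of "fst p" "snd p"] by (cases p) (auto simp: row_precedes_def)
        then show ?thesis using roots unfolding T_def by blast
      next
        case False
        then show ?thesis using 4 disj(1)[of "(fst p, y)" p for y] unfolding T_def row_precedes_def by fastforce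
      qed
      ultimately show ?thesis using node.IH(2) 4 by simp
    qed
  qed
  then show ?case using complete cards unfolding T_def by blast
qed

section \<open>Complete non-ambiguous trees are grid trees\<close>

definition child_rel :: "point set \<Rightarrow> point rel" where
  "child_rel A = {(p, q). q \<in> children A p}"

text \<open>The growing coordinate sum makes the child relation acyclic and serves as an induction
  measure.\<close>

lemma child_rel_less: "(p, q) \<in> child_rel A \<Longrightarrow> fst p + snd p < fst q + snd q"
  by (auto simp: child_rel_def children_def left_child_def right_child_def
      row_precedes_def column_precedes_def)

lemma child_rel_mem: "(p, q) \<in> child_rel A \<Longrightarrow> p \<in> A \<and> q \<in> A"
  by (auto simp: child_rel_def children_def left_child_def right_child_def)

lemma child_rel_rtrancl_mem: "(p, q) \<in> (child_rel A)\<^sup>* \<Longrightarrow> p \<in> A \<Longrightarrow> q \<in> A"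
  by (metis child_rel_mem rtranclE)

text \<open>A nearest predecessor in a row, or in a column, is unique, and the hypothesis excludes
  having one of each kind. Hence the child relation is a forest.\<close>

lemma parent_unique:
  assumes "\<And>p. p \<in> A \<Longrightarrow> \<not> ((\<exists>q\<in>A. row_precedes q p) \<and> (\<exists>q\<in>A. column_precedes q p))"
    and "(p, q) \<in> child_rel A" "(p', q) \<in> child_rel A"
  shows "p = p'"
proof -
  have *: "p = p'" if "right_child A p q" "right_child A p' q" for p p'
    using that unfolding right_child_def row_precedes_def
    by (metis linorder_neqE_nat prod_eqI)
  have **: "p = p'" if "left_child A p q" "left_child A p' q" for p p'
    using that unfolding left_child_def column_precedes_def
    by (metis linorder_neqE_nat prod_eqI)
  have "\<not> (right_child A p q \<and> left_child A p' q)" for p p'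
    using assms(1)[of q] unfolding left_child_def right_child_def by blast
  then show ?thesis
    using assms(2,3) * ** unfolding child_rel_def children_def by blast
qed

section \<open>Existence of parents, and comparability within a row or column\<close>

lemma exists_max_nat:
  fixes f :: "'a \<Rightarrow> nat"
  assumes "finite S" "s \<in> S"
  obtains m where "m \<in> S" "f s \<le> f m" "\<And>x. x \<in> S \<Longrightarrow> f x \<le> f m"
proof -
  have ne: "f ` S \<noteq> {}" "finite (f ` S)" using assms by auto
  then obtain m where "m \<in> S" "f m = Max (f ` S)"
    using Max_in[OF ne(2,1)] by (metis imageE)
  then show ?thesis using that[of m] assms ne by simp
qed

text \<open>The parent is the last point before \<open>p\<close> in its row. The bound on
  \<open>snd q'\<close> records that it does not jump past the given predecessor
  \<open>q\<close>.\<close>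

lemma row_parent_exists:
  assumes "finite A" "p \<in> A" "q \<in> A" "row_precedes q p"
  obtains q' where "right_child A q' p" "snd q \<le> snd q'"
proof -
  obtain m where m: "m \<in> {s \<in> A. row_precedes s p}" "snd q \<le> snd m"
    "\<And>x. x \<in> {s \<in> A. row_precedes s p} \<Longrightarrow> snd x \<le> snd m"
    by (rule exists_max_nat[of "{s \<in> A. row_precedes s p}" q snd]) (use assms in auto)
  have "right_child A m p"
    using m(1) m(3) assms(2) unfolding right_child_def row_precedes_def by fastforce
  then show ?thesis using that m(2) by blast
qed

lemma column_parent_exists:
  assumes "finite A" "p \<in> A" "q \<in> A" "column_precedes q p"
  obtains q' where "left_child A q' p" "fst q \<le> fst q'"
proof -
  obtain m where m: "m \<in> {s \<in> A. column_precedes s p}" "fst q \<le> fst m"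
    "\<And>x. x \<in> {s \<in> A. column_precedes s p} \<Longrightarrow> fst x \<le> fst m"
    by (rule exists_max_nat[of "{s \<in> A. column_precedes s p}" q fst]) (use assms in auto)
  have "left_child A m p"
    using m(1) m(3) assms(2) unfolding left_child_def column_precedes_def by fastforce
  then show ?thesis using that m(2) by blast
qed

text \<open>Going from \<open>p\<close> back to its row parent never passes \<open>q\<close>, so the
  walk ends there. Consequently two points in one row are always ancestor and descendant.\<close>

lemma row_precedes_rtrancl:
  assumes "finite A" "q \<in> A" "p \<in> A" "fst q = fst p" "snd q \<le> snd p"
  shows "(q, p) \<in> (child_rel A)\<^sup>*"
  using assms(3-5)
proof (induction "snd p" arbitrary: p rule: less_induct)
  case less
  show ?case
  proof (cases "q = p")
    case False
    then have "row_precedes q p"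
      using less.prems by (auto simp: row_precedes_def prod_eq_iff)
    then obtain q' where q': "right_child A q' p" "snd q \<le> snd q'"
      using row_parent_exists[OF assms(1) less.prems(1) assms(2)] by blast
    then have "q' \<in> A" "fst q' = fst p" "snd q' < snd p" "(q', p) \<in> child_rel A"
      by (auto simp: right_child_def row_precedes_def child_rel_def children_def)
    then show ?thesis
      using less.hyps[of q'] less.prems q'(2) by (auto intro: rtrancl_into_rtrancl)
  qed simp
qed

lemma column_precedes_rtrancl:
  assumes "finite A" "q \<in> A" "p \<in> A" "snd q = snd p" "fst q \<le> fst p"
  shows "(q, p) \<in> (child_rel A)\<^sup>*"
  using assms(3-5)
proof (induction "fst p" arbitrary: p rule: less_induct)
  case less
  show ?case
  proof (cases "q = p")
    case False
    then have "column_precedes q p"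
      using less.prems by (auto simp: column_precedes_def prod_eq_iff)
    then obtain q' where q': "left_child A q' p" "fst q \<le> fst q'"
      using column_parent_exists[OF assms(1) less.prems(1) assms(2)] by blast
    then have "q' \<in> A" "snd q' = snd p" "fst q' < fst p" "(q', p) \<in> child_rel A"
      by (auto simp: left_child_def column_precedes_def child_rel_def children_def)
    then show ?thesis
      using less.hyps[of q'] less.prems q'(2) by (auto intro: rtrancl_into_rtrancl)
  qed simp
qed

section \<open>Relations in which every element has at most one predecessor\<close>

lemma rtrancl_common_descendant:
  assumes "single_valued (E\<inverse>)" "(x, z) \<in> E\<^sup>*" "(y, z) \<in> E\<^sup>*"
  shows "(x, y) \<in> E\<^sup>* \<or> (y, x) \<in> E\<^sup>*"
  using single_valued_confluent[OF assms(1), of z x y] assms(2,3)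
  by (auto simp: rtrancl_converse)

text \<open>A common descendant would make one sibling an ancestor of the other. The path between
  them must enter the lower one through its only predecessor \<open>p\<close>, which closes a cycle
  through \<open>p\<close>.\<close>

lemma siblings_no_common_descendant:
  assumes sv: "single_valued (E\<inverse>)" and ac: "acyclic E"
    and "(p, l) \<in> E" "(p, s) \<in> E" "l \<noteq> s"
    and "(l, z) \<in> E\<^sup>*" "(s, z) \<in> E\<^sup>*"
  shows False
proof -
  have *: False if "(p, l) \<in> E" "(p, s) \<in> E" "l \<noteq> s" "(l, s) \<in> E\<^sup>*" for l s
  proof -
    obtain q where "(l, q) \<in> E\<^sup>*" "(q, s) \<in> E"
      using \<open>(l, s) \<in> E\<^sup>*\<close> \<open>l \<noteq> s\<close> by (metis rtranclE)
    moreover have "q = p"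
      using sv that(2) \<open>(q, s) \<in> E\<close> by (auto dest: single_valuedD)
    ultimately have "(p, p) \<in> E\<^sup>+"
      using that(1) by (simp add: rtrancl_into_trancl2)
    then show False using ac by (simp add: acyclic_def)
  qed
  show False
    using rtrancl_common_descendant[OF sv assms(6,7)] *[of l s] *[of s l] assms(3-5) by blast
qed

lemma siblings_incomparable:
  assumes sv: "single_valued (E\<inverse>)" and ac: "acyclic E"
    and "(p, l) \<in> E" "(p, s) \<in> E" "l \<noteq> s"
    and "(l, x) \<in> E\<^sup>*" "(s, y) \<in> E\<^sup>*"
  shows "(x, y) \<notin> E\<^sup>*" "(y, x) \<notin> E\<^sup>*"
  using siblings_no_common_descendant[OF sv ac assms(3-5)] assms(6,7)
  by (meson rtrancl_trans)+

text \<open>Induction from the leaves towards the root. The descendants of the two children form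
  grid trees by induction, and they share no row or column because points in a common row or column
  would be comparable.\<close>

lemma grid_tree_descendants:
  assumes fin: "finite A" and complete: "complete_tree A"
    and unique: "\<And>p. p \<in> A \<Longrightarrow> \<not> ((\<exists>q\<in>A. row_precedes q p) \<and> (\<exists>q\<in>A. column_precedes q p))"
    and "p \<in> A"
  shows "grid_tree (fst p) (snd p) ((child_rel A)\<^sup>* `` {p})"
  using \<open>p \<in> A\<close>
proof -
  let ?E = "child_rel A"
  have sv: "single_valued (?E\<inverse>)"
    using parent_unique[OF unique] by (auto simp: single_valued_def)
  have wf: "wf (?E\<inverse>)"
  proof -
    have "?E \<subseteq> A \<times> A" using child_rel_mem by auto
    then have "finite ?E" using fin finite_subset by blast
    moreover have ac: "acyclic ?E"
      \<comment> \<open>The rule expects a measure that decreases along edges, hence the negated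
        coordinate sum.\<close>
      by (rule acyclicI_order[of _ "\<lambda>p. - int (fst p + snd p)"]) (use child_rel_less in fastforce)
    ultimately show ?thesis by (rule finite_acyclic_wf_converse)
  qed
  then have ac: "acyclic ?E" using wf_acyclic by (metis acyclic_converse)
  show ?thesis using wf \<open>p \<in> A\<close>
  proof (induction p rule: wf_induct_rule)
    case (less p)
    have kids: "children A p = {q. (p, q) \<in> ?E}" by (simp add: child_rel_def)
    consider "card (children A p) = 0" | "card (children A p) = 2"
      using complete less.prems unfolding complete_tree_def by metis
    then show ?case
    proof cases
      case 1
      have "children A p \<subseteq> A"
        unfolding kids using child_rel_mem by blast
      then have "finite (children A p)" using fin finite_subset by blast
      then have "?E\<^sup>* `` {p} = {p}"
        using 1 kids by (auto elim: converse_rtranclE)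
      then show ?thesis using grid_tree.leaf[of "fst p" "snd p"] by simp
    next
      case 2
      \<comment> \<open>There is at most one child of each kind, so two children are one left and
        one right child.\<close>
      have left_eq: "q = q'" if "left_child A p q" "left_child A p q'" for q q'
        using that unfolding left_child_def column_precedes_def
        by (metis linorder_neqE_nat prod_eqI)
      have right_eq: "q = q'" if "right_child A p q" "right_child A p q'" for q q'
        using that unfolding right_child_def row_precedes_def
        by (metis linorder_neqE_nat prod_eqI)
      obtain u v where uv: "children A p = {u, v}" "u \<noteq> v"
        using 2 by (meson card_2_iff)
      then have "u \<in> children A p" "v \<in> children A p" by simp_all
      then have "left_child A p u \<and> right_child A p v \<or> left_child A p v \<and> right_child A p u"
        using left_eq[of u v] right_eq[of u v] uv(2) by (auto simp: children_def)
      then obtain l s where ls: "left_child A p l" "right_child A p s" "children A p = {l, s}"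
        using uv(1) by (elim disjE conjE) (simp_all add: insert_commute)
      have l: "l \<in> A" "snd l = snd p" "fst p < fst l" "(p, l) \<in> ?E"
        and s: "s \<in> A" "fst s = fst p" "snd p < snd s" "(p, s) \<in> ?E"
        using ls by (auto simp: left_child_def right_child_def row_precedes_def
            column_precedes_def child_rel_def children_def)
      have "l \<noteq> s" using l s by auto
      let ?L = "?E\<^sup>* `` {l}" and ?S = "?E\<^sup>* `` {s}"
      have sub: "?L \<subseteq> A" "?S \<subseteq> A"
        using child_rel_rtrancl_mem l(1) s(1) by blast+
      note incomp = siblings_incomparable[OF sv ac l(4) s(4) \<open>l \<noteq> s\<close>]
      have "fst x \<noteq> fst y \<and> snd x \<noteq> snd y" if "x \<in> ?L" "y \<in> ?S" for x y
        using that sub incomp[of x y] row_precedes_rtrancl[OF fin, of x y]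
          row_precedes_rtrancl[OF fin, of y x] column_precedes_rtrancl[OF fin, of x y]
          column_precedes_rtrancl[OF fin, of y x]
        by (metis Image_singleton_iff nle_le subsetD)
      then have disj: "fst ` ?L \<inter> fst ` ?S = {}" "snd ` ?L \<inter> snd ` ?S = {}"
        by blast+
      have "grid_tree (fst l) (snd p) ?L" "grid_tree (fst p) (snd s) ?S"
        using less.IH[of l] less.IH[of s] l s by simp_all
      then have "grid_tree (fst p) (snd p) (insert (fst p, snd p) (?L \<union> ?S))"
        using l s disj by (intro grid_tree.node) simp_all
      moreover have "?E\<^sup>* `` {p} = insert p (?L \<union> ?S)"
        using ls(3) l(4) s(4) kids
        by (auto elim: converse_rtranclE intro: converse_rtrancl_into_rtrancl)
      ultimately show ?thesis by simp
    qed
  qed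
qed

text \<open>From left to right, every point descends from the origin because each other point has a
  parent, so the descendants of the origin are all of \<open>A\<close>. The absence of gaps among
  the coordinates is treated separately, when counting.\<close>

lemma complete_nat_iff_grid_tree:
  assumes "finite A" "(0, 0) \<in> A"
  shows "(\<forall>p\<in>A. p \<noteq> (0, 0) \<longrightarrow>
        (\<exists>q\<in>A. row_precedes q p) \<noteq> (\<exists>q\<in>A. column_precedes q p)) \<and> complete_tree A
     \<longleftrightarrow> grid_tree 0 0 A"
proof
  assume A: "(\<forall>p\<in>A. p \<noteq> (0, 0) \<longrightarrow>
        (\<exists>q\<in>A. row_precedes q p) \<noteq> (\<exists>q\<in>A. column_precedes q p)) \<and> complete_tree A"
  have "\<not> ((\<exists>q\<in>A. row_precedes q p) \<and> (\<exists>q\<in>A. column_precedes q p))" if "p \<in> A" for p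
    using A that by (cases "p = (0, 0)") (auto simp: row_precedes_def)
  then have "grid_tree 0 0 ((child_rel A)\<^sup>* `` {(0, 0)})"
    using grid_tree_descendants[OF assms(1) _ _ assms(2)] A by simp
  moreover have "((0, 0), p) \<in> (child_rel A)\<^sup>*" if "p \<in> A" for p
    using that
  proof (induction "fst p + snd p" arbitrary: p rule: less_induct)
    case less
    show ?case
    proof (cases "p = (0, 0)")
      case False
      then obtain q where "(q, p) \<in> child_rel A"
        using A less.prems row_parent_exists[OF assms(1) less.prems]
          column_parent_exists[OF assms(1) less.prems]
        unfolding child_rel_def children_def by (metis (mono_tags, lifting) case_prodI mem_Collect_eq)
      then show ?thesis
        using less.hyps[of q] child_rel_less[of q p] child_rel_mem[of q p]
        by (auto intro: rtrancl_into_rtrancl)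
    qed simp
  qed
  moreover have "p \<in> A" if "((0, 0), p) \<in> (child_rel A)\<^sup>*" for p
    using child_rel_rtrancl_mem[OF that assms(2)] .
  ultimately show "grid_tree 0 0 A"
    by (metis (no_types, lifting) Image_singleton_iff subsetI subset_antisym)
next
  assume "grid_tree 0 0 A"
  then show "(\<forall>p\<in>A. p \<noteq> (0, 0) \<longrightarrow>
        (\<exists>q\<in>A. row_precedes q p) \<noteq> (\<exists>q\<in>A. column_precedes q p)) \<and> complete_tree A"
    using grid_tree_structure by blast
qed

section \<open>Counting\<close>

definition grid_trees :: "nat set \<Rightarrow> nat set \<Rightarrow> point set set" where
  "grid_trees R C = {A. grid_tree (Min R) (Min C) A \<and> fst ` A = R \<and> snd ` A = C}"

text \<open>The recursion obtained by splitting at the root, with \<open>i\<close> the number of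
  internal vertices of the left subtree.\<close>

fun tree_number :: "nat \<Rightarrow> nat" where
  "tree_number k = (if k = 0 then 1 else
     (\<Sum>i<k. (k choose Suc i) * (k choose i) * (tree_number i * tree_number (k - 1 - i))))"

declare tree_number.simps [simp del]

lemma grid_tree_imp_grid_trees:
  "grid_tree r c A \<Longrightarrow> A \<in> grid_trees (fst ` A) (snd ` A)"
  by (simp add: grid_trees_def grid_tree_Min)

lemma finite_grid_trees:
  assumes "finite R" "finite C"
  shows "finite (grid_trees R C)"
proof (rule finite_subset)
  show "grid_trees R C \<subseteq> Pow (R \<times> C)"
    by (force simp: grid_trees_def)
qed (use assms in simp)

lemma grid_trees_singleton: "grid_trees {r} {c} = {{(r, c)}}"
proof
  show "grid_trees {r} {c} \<subseteq> {{(r, c)}}"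
  proof
    fix A assume "A \<in> grid_trees {r} {c}"
    then have "(r, c) \<in> A" "fst ` A = {r}" "snd ` A = {c}"
      using grid_tree_root by (auto simp: grid_trees_def)
    then have "A = {(r, c)}" by (force simp: prod_eq_iff)
    then show "A \<in> {{(r, c)}}" by simp
  qed
  show "{{(r, c)}} \<subseteq> grid_trees {r} {c}"
    using grid_tree.leaf by (simp add: grid_trees_def)
qed

text \<open>\<open>X\<close> holds the rows of the left subtree and \<open>Y\<close> the columns of
  the right one. The minima are left out because the row of the root belongs to the right subtree
  and its column to the left one.\<close>

definition splits :: "nat set \<Rightarrow> nat set \<Rightarrow> nat \<Rightarrow> nat \<Rightarrow> (nat set \<times> nat set) set" where
  "splits R C k i = {X. X \<subseteq> R - {Min R} \<and> card X = Suc i} \<times> {Y. Y \<subseteq> C - {Min C} \<and> card Y = k - i}"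

text \<open>A tree with more than one point amounts to a choice of \<open>i\<close>, of a split of
  the rows and columns, and of one tree on each side.\<close>

lemma grid_trees_node_bij:
  assumes "card R = Suc k" "card C = Suc k" "0 < k"
  shows "bij_betw (\<lambda>(i, XY, A, B). insert (Min R, Min C) (A \<union> B))
    (SIGMA i:{..<k}. SIGMA XY:splits R C k i.
      grid_trees (fst XY) (C - snd XY) \<times> grid_trees (R - fst XY) (snd XY))
    (grid_trees R C)"
    (is "bij_betw ?g ?S _")
proof -
  let ?r = "Min R" and ?c = "Min C"
  have fin: "finite R" "finite C" and ne: "R \<noteq> {}" "C \<noteq> {}"
    using assms by (auto intro: card_ge_0_finite)
  have node: "grid_tree (Min X) ?c A \<and> grid_tree ?r (Min Y) B \<and> ?r < Min X \<and> ?c < Min Y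
      \<and> fst ` A = X \<and> snd ` A = C - Y \<and> fst ` B = R - X \<and> snd ` B = Y"
    if "(X, Y) \<in> splits R C k i" "i < k" "A \<in> grid_trees X (C - Y)" "B \<in> grid_trees (R - X) Y"
    for i X Y A B
  proof -
    have XY: "X \<subseteq> R - {?r}" "Y \<subseteq> C - {?c}" "card X = Suc i" "card Y = k - i"
      using that by (auto simp: splits_def)
    have "X \<noteq> {}" "Y \<noteq> {}" using XY(3,4) \<open>i < k\<close> by auto
    moreover have "finite X" "finite Y" using XY fin finite_subset by blast+
    ultimately have "Min X \<in> R - {?r}" "Min Y \<in> C - {?c}"
      using XY by (meson Min_in subsetD)+
    then have "?r < Min X" "?c < Min Y"
      using fin by (auto simp: order_less_le)
    moreover have "?r \<in> R - X" "?c \<in> C - Y"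
      using XY fin ne by auto
    then have "Min (R - X) = ?r" "Min (C - Y) = ?c"
      using fin by (auto intro!: Min_eqI)
    ultimately show ?thesis
      using that by (auto simp: grid_trees_def)
  qed
  show ?thesis
    unfolding bij_betw_def
  proof (intro conjI subset_antisym)
    show "inj_on ?g ?S"
    proof (rule inj_onI)
      fix s t assume st: "s \<in> ?S" "t \<in> ?S" "?g s = ?g t"
      obtain i X Y A B where s: "s = (i, (X, Y), A, B)" by (metis surj_pair)
      obtain i' X' Y' A' B' where t: "t = (i', (X', Y'), A', B')" by (metis surj_pair)
      have 1: "(X, Y) \<in> splits R C k i" "i < k" "A \<in> grid_trees X (C - Y)" "B \<in> grid_trees (R - X) Y"
        using st(1) s by auto
      have 2: "(X', Y') \<in> splits R C k i'" "i' < k" "A' \<in> grid_trees X' (C - Y')"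
        "B' \<in> grid_trees (R - X') Y'"
        using st(2) t by auto
      have eq: "insert (?r, ?c) (A \<union> B) = insert (?r, ?c) (A' \<union> B')"
        using st(3) s t by simp
      note n1 = node[OF 1] and n2 = node[OF 2]
      have "A = A' \<and> B = B'"
        by (rule grid_tree_node_inject[OF _ _ _ _ _ _ _ _ _ _ _ _ eq]) (use n1 n2 in auto)
      then have "A = A'" "B = B'" "X = X'" "Y = Y'"
        using n1 n2 by auto
      \<comment> \<open>The index is recovered from \<open>card X = Suc i\<close>.\<close>
      moreover have "i = i'"
        using 1(1) 2(1) \<open>X = X'\<close> by (auto simp: splits_def)
      ultimately show "s = t" using s t by simp
    qed
  next
    show "?g ` ?S \<subseteq> grid_trees R C"
    proof
      fix T assume "T \<in> ?g ` ?S"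
      then obtain i X Y A B where 1: "(X, Y) \<in> splits R C k i" "i < k"
        "A \<in> grid_trees X (C - Y)" "B \<in> grid_trees (R - X) Y"
        and T: "T = insert (?r, ?c) (A \<union> B)"
        by auto
      note n = node[OF 1]
      have "X \<subseteq> R" "Y \<subseteq> C" using 1(1) by (auto simp: splits_def)
      have "grid_tree ?r ?c T"
        unfolding T by (rule grid_tree.node[of "Min X" ?c A ?r "Min Y" B]) (use n in auto)
      moreover have "fst ` T = R" "snd ` T = C"
        unfolding T using n \<open>X \<subseteq> R\<close> \<open>Y \<subseteq> C\<close> Min_in[OF fin(1) ne(1)] Min_in[OF fin(2) ne(2)]
        by (auto simp: image_Un)
      ultimately show "T \<in> grid_trees R C" by (simp add: grid_trees_def)
    qed
  next
    show "grid_trees R C \<subseteq> ?g ` ?S"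
    proof
      fix T assume "T \<in> grid_trees R C"
      then have T: "grid_tree ?r ?c T" "fst ` T = R" "snd ` T = C"
        by (auto simp: grid_trees_def)
      have "T \<noteq> {(?r, ?c)}"
      proof
        assume "T = {(?r, ?c)}"
        then have "card (fst ` T) = 1" by (metis card_1_singleton_iff image_empty image_insert One_nat_def)
        then show False using T(2) assms by simp
      qed
      then obtain r' c' A B where n: "grid_tree r' ?c A" "grid_tree ?r c' B" "?r < r'" "?c < c'"
        "fst ` A \<inter> fst ` B = {}" "snd ` A \<inter> snd ` B = {}" "T = insert (?r, ?c) (A \<union> B)"
        using grid_tree_nodeE[OF T(1)] by metis
      define X W Y Z i where "X = fst ` A" and "W = fst ` B" and "Y = snd ` B" and "Z = snd ` A"
        and "i = card (internal_vertices A)"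
      have roots: "?r \<in> W" "?c \<in> Z"
        using grid_tree_root[OF n(1)] grid_tree_root[OF n(2)]
        unfolding W_def Z_def by (auto intro: rev_image_eqI)
      have disj: "X \<inter> W = {}" "Z \<inter> Y = {}"
        using n(5,6) unfolding X_def W_def Y_def Z_def by simp_all
      have "R = fst ` insert (?r, ?c) (A \<union> B)" "C = snd ` insert (?r, ?c) (A \<union> B)"
        using T(2,3) n(7) by metis+
      then have "R = insert ?r (X \<union> W)" "C = insert ?c (Z \<union> Y)"
        unfolding image_insert image_Un fst_conv snd_conv X_def W_def Y_def Z_def .
      then have R: "R = X \<union> W" and C: "C = Z \<union> Y"
        using roots by (metis Un_insert_left Un_insert_right insert_absorb)+
      have RX: "R - X = W" and CY: "C - Y = Z"
        using R C disj by blast+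
      \<comment> \<open>A grid tree has as many rows as columns, and one more than internal
        vertices. Applied to \<open>B\<close>, this turns the row count \<open>card W\<close> into
        the column count \<open>card Y\<close>.\<close>
      have cards: "card X = Suc i" "card W = card Y" "0 < card Y"
        using grid_tree_structure[OF n(1)] grid_tree_structure[OF n(2)]
        unfolding X_def Y_def W_def i_def by simp_all
      have "card (X \<union> W) = card X + card W"
        using fin(1) R disj(1) by (intro card_Un_disjoint) (auto intro: finite_subset)
      then have "Suc k = card X + card W" using assms(1) R by metis
      then have ik: "i < k" "card Y = k - i" using cards by auto
      have "X \<subseteq> R - {?r}" "Y \<subseteq> C - {?c}"
        using R C roots disj by blast+
      then have "(X, Y) \<in> splits R C k i"
        using cards(1) ik(2) unfolding splits_def by simp
      moreover have "A \<in> grid_trees X (C - Y)" "B \<in> grid_trees (R - X) Y"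
        using grid_tree_imp_grid_trees[OF n(1)] grid_tree_imp_grid_trees[OF n(2)]
        unfolding RX CY unfolding X_def Y_def W_def Z_def by simp_all
      ultimately have "(i, (X, Y), A, B) \<in> ?S" using ik by simp
      moreover have "T = ?g (i, (X, Y), A, B)" using n(7) by simp
      ultimately show "T \<in> ?g ` ?S" by (rule rev_image_eqI)
    qed
  qed
qed

text \<open>The count depends only on the sizes of \<open>R\<close> and \<open>C\<close>, so the
  induction applies to the subtrees whichever rows and columns they receive.\<close>

lemma card_grid_trees:
  assumes "card R = Suc k" "card C = Suc k"
  shows "card (grid_trees R C) = tree_number k"
  using assms
proof (induction k arbitrary: R C rule: less_induct)
  case (less k)
  have fin: "finite R" "finite C" and ne: "R \<noteq> {}" "C \<noteq> {}"
    using less.prems by (auto intro: card_ge_0_finite)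
  show ?case
  proof (cases "k = 0")
    case True
    then obtain r c where "R = {r}" "C = {c}"
      using less.prems by (auto simp: card_1_singleton_iff)
    then show ?thesis
      using True by (simp add: grid_trees_singleton tree_number.simps)
  next
    case False
    let ?F = "\<lambda>XY. grid_trees (fst XY) (C - snd XY) \<times> grid_trees (R - fst XY) (snd XY)"
    have fin_splits: "finite (splits R C k i)" for i
      using fin by (simp add: splits_def)
    have finF: "finite (?F XY)" if "XY \<in> splits R C k i" for XY i
    proof -
      have "fst XY \<subseteq> R" "snd XY \<subseteq> C"
        using that by (auto simp: splits_def)
      then have "finite (fst XY)" "finite (snd XY)"
        using fin finite_subset by blast+
      then show ?thesis using fin by (simp add: finite_grid_trees)
    qed
    have cardF: "card (?F XY) = tree_number i * tree_number (k - 1 - i)"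
      if i: "XY \<in> splits R C k i" "i < k" for XY i
    proof -
      obtain X Y where XY: "XY = (X, Y)" "X \<subseteq> R" "Y \<subseteq> C" "card X = Suc i" "card Y = k - i"
        using i(1) by (auto simp: splits_def)
      have "card (C - Y) = Suc i" "card (R - X) = Suc (k - 1 - i)" "card Y = Suc (k - 1 - i)"
        using XY less.prems fin \<open>i < k\<close> by (auto simp: card_Diff_subset finite_subset)
      then show ?thesis
        using XY less.IH[of i X "C - Y"] less.IH[of "k - 1 - i" "R - X" Y] \<open>i < k\<close>
        by (simp add: card_cartesian_product)
    qed
    \<comment> \<open>The second factor chooses \<open>k - i\<close> of the \<open>k\<close>
      non-minimal columns, which by symmetry gives \<open>k choose i\<close>.\<close>
    have card_splits: "card (splits R C k i) = (k choose Suc i) * (k choose i)" if "i < k" for i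
      using that less.prems fin ne n_subsets[of "R - {Min R}" "Suc i"]
        n_subsets[of "C - {Min C}" "k - i"] binomial_symmetric[of i k]
      by (simp add: splits_def card_cartesian_product)
    have "card (grid_trees R C) = card (SIGMA i:{..<k}. SIGMA XY:splits R C k i. ?F XY)"
      using bij_betw_same_card[OF grid_trees_node_bij[OF less.prems]] False by simp
    also have "\<dots> = (\<Sum>i<k. \<Sum>XY\<in>splits R C k i. card (?F XY))"
      using fin_splits finF by (simp add: card_SigmaI)
    also have "\<dots> = (\<Sum>i<k. card (splits R C k i) * (tree_number i * tree_number (k - 1 - i)))"
      using cardF by (intro sum.cong) auto
    also have "\<dots> = tree_number k"
      using False card_splits by (subst tree_number.simps) simp
    finally show ?thesis .
  qed
qed

text \<open>The condition that no coordinate is skipped makes the occupied rows and columns initial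
  segments; \<open>grid_tree_structure\<close> fixes their size at \<open>k + 1\<close>.\<close>

lemma complete_nats_eq_grid_trees: "complete_nats k = grid_trees {0..k} {0..k}"
proof -
  have down: "S = {0..k}" if "finite S" "card S = Suc k" "\<And>x x'. x \<in> S \<Longrightarrow> x' < x \<Longrightarrow> x' \<in> S"
    for S :: "nat set"
  proof -
    have "S \<noteq> {}" using that(2) by auto
    then have "Max S \<in> S" using that(1) by simp
    then have "x \<in> S" if "x \<le> Max S" for x
      using \<open>\<And>x x'. x \<in> S \<Longrightarrow> x' < x \<Longrightarrow> x' \<in> S\<close> that by (cases "x = Max S") auto
    then have "S = {0..Max S}"
      using that(1) by auto
    then show ?thesis using that(2) by (metis card_atLeastAtMost diff_zero nat.inject)
  qed
  have "A \<in> complete_nats k \<longleftrightarrow> A \<in> grid_trees {0..k} {0..k}" for A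
  proof
    assume A: "A \<in> complete_nats k"
    then have f: "finite A" "(0, 0) \<in> A" and k: "card (internal_vertices A) = k"
      and g: "\<forall>p\<in>A. (\<forall>x'<fst p. \<exists>q\<in>A. fst q = x') \<and> (\<forall>y'<snd p. \<exists>q\<in>A. snd q = y')"
      by (auto simp: complete_nats_def non_ambiguous_tree_def)
    have t: "grid_tree 0 0 A"
      using A complete_nat_iff_grid_tree[OF f]
      unfolding complete_nats_def non_ambiguous_tree_def by blast
    have "x' \<in> fst ` A" if x: "x \<in> fst ` A" "x' < x" for x x'
    proof -
      obtain p where "p \<in> A" "x = fst p" using x(1) by blast
      then obtain q where "q \<in> A" "fst q = x'" using g x(2) by blast
      then show ?thesis by blast
    qed
    then have "fst ` A = {0..k}"
      using f(1) k grid_tree_structure[OF t] by (intro down) simp_all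
    moreover have "y' \<in> snd ` A" if y: "y \<in> snd ` A" "y' < y" for y y'
    proof -
      obtain p where "p \<in> A" "y = snd p" using y(1) by blast
      then obtain q where "q \<in> A" "snd q = y'" using g y(2) by blast
      then show ?thesis by blast
    qed
    then have "snd ` A = {0..k}"
      using f(1) k grid_tree_structure[OF t] by (intro down) simp_all
    ultimately show "A \<in> grid_trees {0..k} {0..k}"
      using grid_tree_imp_grid_trees[OF t] by simp
  next
    assume "A \<in> grid_trees {0..k} {0..k}"
    moreover have "Min {0..k} = 0" by (auto intro: Min_eqI)
    ultimately have t: "grid_tree 0 0 A" and im: "fst ` A = {0..k}" "snd ` A = {0..k}"
      by (auto simp: grid_trees_def)
    have f: "finite A" "(0, 0) \<in> A"
      using grid_tree_finite[OF t] grid_tree_root[OF t] by auto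
    have "x' \<in> fst ` A" if "p \<in> A" "x' < fst p" for p x'
    proof -
      have "fst p \<in> {0..k}" using im(1) that(1) by blast
      then show ?thesis using im(1) that(2) by simp
    qed
    moreover have "y' \<in> snd ` A" if "p \<in> A" "y' < snd p" for p y'
    proof -
      have "snd p \<in> {0..k}" using im(2) that(1) by blast
      then show ?thesis using im(2) that(2) by simp
    qed
    ultimately have
      "\<forall>p\<in>A. (\<forall>x'<fst p. \<exists>q\<in>A. fst q = x') \<and> (\<forall>y'<snd p. \<exists>q\<in>A. snd q = y')"
      by (fastforce simp: image_iff)
    moreover have "card (internal_vertices A) = k"
      using grid_tree_structure[OF t] im by simp
    ultimately show "A \<in> complete_nats k"
      using f t complete_nat_iff_grid_tree[OF f]
      unfolding complete_nats_def non_ambiguous_tree_def by auto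
  qed
  then show ?thesis by blast
qed

lemma num_complete_nats_eq: "num_complete_nats k = tree_number k"
  by (simp add: num_complete_nats_def complete_nats_eq_grid_trees card_grid_trees)

section \<open>Generating functions\<close>

unbundle fps_syntax

text \<open>The weights are chosen so that the two binomials in the recursion are absorbed and an
  ordinary Cauchy product remains.\<close>

definition tree_fps :: "rat fps" where
  "tree_fps = Abs_fps (\<lambda>k. of_nat (tree_number k) / (fact k * fact (Suc k)))"

text \<open>The power series of the Bessel function \<open>J_0\<close> evaluated at
  \<open>2 * sqrt x\<close>.\<close>

definition bessel_fps :: "rat fps" where
  "bessel_fps = Abs_fps (\<lambda>m. (- 1) ^ m / (fact m)\<^sup>2)"

text \<open>The coefficient of \<open>x^n\<close> on the left is
  \<open>tree_number n / (n!)^2\<close>, which the recursion identifies with the coefficient of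
  \<open>x^(n-1)\<close> in the square. The constant 1 accounts for the single leaf.\<close>

lemma tree_fps_riccati: "fps_deriv (fps_X * tree_fps) = 1 + fps_X * tree_fps\<^sup>2"
proof (rule fps_ext)
  fix n
  show "fps_deriv (fps_X * tree_fps) $ n = (1 + fps_X * tree_fps\<^sup>2) $ n"
  proof (cases n)
    case 0
    then show ?thesis
      by (simp add: tree_fps_def tree_number.simps)
  next
    case (Suc m)
    have "of_nat (tree_number n) / (fact n * fact n) = (tree_fps\<^sup>2) $ m"
    proof -
      have "of_nat ((n choose Suc i) * (n choose i) * (tree_number i * tree_number (n - 1 - i)))
          / (fact n * fact n) = tree_fps $ i * tree_fps $ (m - i)" if "i \<le> m" for i
      proof -
        have eqs: "n - Suc i = m - i" "n - i = Suc (m - i)" "n - 1 - i = m - i"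
          using Suc that by simp_all
        have "of_nat (n choose Suc i) = (fact n / (fact (Suc i) * fact (m - i)) :: rat)"
          "of_nat (n choose i) = (fact n / (fact i * fact (Suc (m - i))) :: rat)"
          using binomial_fact[of "Suc i" n] binomial_fact[of i n] that Suc
          unfolding eqs by (simp_all del: fact_Suc)
        then show ?thesis
          unfolding eqs of_nat_mult by (simp add: tree_fps_def del: fact_Suc)
      qed
      moreover have "tree_number n = (\<Sum>i=0..m. (n choose Suc i) * (n choose i)
          * (tree_number i * tree_number (n - 1 - i)))"
        using Suc by (subst tree_number.simps) (simp add: atLeast0AtMost lessThan_Suc_atMost)
      ultimately show ?thesis
        by (simp add: power2_eq_square fps_mult_nth sum_divide_distrib)
    qed
    moreover have "of_nat (Suc n) * tree_fps $ n = of_nat (tree_number n) / (fact n * fact n)"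
      by (simp add: tree_fps_def del: of_nat_Suc)
    moreover have "fps_deriv (fps_X * tree_fps) $ n = of_nat (Suc n) * tree_fps $ n"
      by (simp del: fps_deriv_mult of_nat_Suc)
    ultimately show ?thesis using Suc by simp
  qed
qed

text \<open>The linear second-order equation to which the substitution \<open>u = - J' / J\<close>
  reduces the Riccati equation. On coefficients it says that consecutive ones have ratio
  \<open>- 1 / (n + 1)^2\<close>.\<close>

lemma bessel_fps_ode: "fps_deriv (fps_X * fps_deriv bessel_fps) = - bessel_fps"
proof (rule fps_ext)
  fix n
  have "fps_deriv (fps_X * fps_deriv bessel_fps) $ n
      = of_nat (Suc n) * (of_nat (Suc n) * bessel_fps $ Suc n)"
    by (simp del: fps_deriv_mult of_nat_Suc)
  also have "\<dots> = (- bessel_fps) $ n"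
    by (simp add: bessel_fps_def power2_eq_square del: of_nat_Suc)
  finally show "fps_deriv (fps_X * fps_deriv bessel_fps) $ n = (- bessel_fps) $ n" .
qed

text \<open>The equation expresses \<open>n\<close> times the coefficient \<open>n\<close> of
  \<open>v\<close> through earlier coefficients of \<open>v\<close>, so all vanish once the first
  does.\<close>

lemma fps_linear_ode_zero:
  fixes u v :: "'a :: field_char_0 fps"
  assumes "fps_deriv v = u * v" "v $ 0 = 0"
  shows "v = 0"
proof (rule fps_ext)
  fix n
  show "v $ n = 0 $ n"
  proof (induction n rule: less_induct)
    case (less n)
    show ?case
    proof (cases n)
      case 0
      then show ?thesis using assms(2) by simp
    next
      case (Suc m)
      have "of_nat n * v $ n = (u * v) $ m"
        using assms(1) Suc by (metis Suc_eq_plus1 fps_deriv_nth)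
      also have "\<dots> = 0"
        using less Suc by (simp add: fps_mult_nth)
      finally show ?thesis using Suc by (simp del: of_nat_Suc)
    qed
  qed
qed

text \<open>With \<open>w = u J + J'\<close>, both differential equations together give
  \<open>(x w)' = u (x w)\<close>. The factor \<open>x\<close> supplies the zero initial value, so
  \<open>x w = 0\<close> by uniqueness.\<close>

lemma tree_fps_bessel: "tree_fps * bessel_fps + fps_deriv bessel_fps = 0" (is "?w = 0")
proof -
  let ?u = tree_fps and ?J = bessel_fps
  have "fps_deriv (fps_X * ?w)
      = fps_deriv (fps_X * ?u) * ?J + fps_X * ?u * fps_deriv ?J + fps_deriv (fps_X * fps_deriv ?J)"
    by (simp add: algebra_simps)
  also have "\<dots> = ?u * (fps_X * ?w)"
    unfolding tree_fps_riccati bessel_fps_ode by (simp add: algebra_simps power2_eq_square)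
  finally have "fps_X * ?w = 0"
    by (rule fps_linear_ode_zero) simp
  then show ?thesis by simp
qed

theorem proposition11:
  fixes n :: nat
  assumes "n \<ge> 1"
  shows "(\<Sum>k = 0..n - 1. (- 1 :: int) ^ k * int (n choose (k + 1)) * int ((n - 1) choose k) * int (num_complete_nats k)) = 1"
proof -
  obtain m where n: "n = Suc m" using assms by (cases n) auto
  \<comment> \<open>This factor turns the product of the coefficients \<open>k\<close> and
    \<open>m - k\<close> into the signed product of binomials; the sign works because
    \<open>m + (m - k)\<close> and \<open>k\<close> have the same parity.\<close>
  let ?c = "(- 1 :: rat) ^ m * fact n * fact m"
  let ?f = "\<lambda>k. (- 1) ^ k * int (n choose (k + 1)) * int ((n - 1) choose k) * int (num_complete_nats k)"
  have "?c * (tree_fps $ k * bessel_fps $ (m - k)) = of_int (?f k)" if "k \<le> m" for k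
  proof -
    have "(- 1 :: rat) ^ m * (- 1) ^ (m - k) = (- 1) ^ k"
      using that by (auto simp flip: power_add simp: minus_one_power_iff)
    moreover have "of_nat (n choose (k + 1)) = (fact n / (fact (Suc k) * fact (m - k)) :: rat)"
      "of_nat ((n - 1) choose k) = (fact m / (fact k * fact (m - k)) :: rat)"
      using that n binomial_fact[of "Suc k" n] binomial_fact[of k m] by (simp_all del: fact_Suc)
    moreover have "?c * (tree_fps $ k * bessel_fps $ (m - k)) = ((- 1) ^ m * (- 1) ^ (m - k))
        * (fact n / (fact (Suc k) * fact (m - k))) * (fact m / (fact k * fact (m - k)))
        * of_nat (tree_number k)"
      by (simp add: tree_fps_def bessel_fps_def power2_eq_square ac_simps del: fact_Suc)
    ultimately show ?thesis
      by (simp add: num_complete_nats_eq)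
  qed
  then have "of_int (\<Sum>k=0..m. ?f k) = ?c * (tree_fps * bessel_fps) $ m"
    by (simp add: fps_mult_nth sum_distrib_left)
  also have "(tree_fps * bessel_fps) $ m = - (fps_deriv bessel_fps $ m)"
    using tree_fps_bessel by (metis add_eq_0_iff2 fps_neg_nth)
  \<comment> \<open>The coefficient of \<open>x^m\<close> in \<open>J'\<close> is
    \<open>(m + 1) (-1)^(m+1) / ((m+1)!)^2 = - (-1)^m / (n! m!)\<close>, so its negative is the
    reciprocal of \<open>?c\<close>.\<close>
  also have "?c * \<dots> = 1"
    using n by (cases "even m") (simp_all add: bessel_fps_def power2_eq_square del: of_nat_Suc)
  finally have "(\<Sum>k=0..m. ?f k) = 1" by (simp only: of_int_eq_1_iff)
  then show ?thesis using n by (simp only: diff_Suc_1)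
qed

end
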